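(* Let $f=f^++f^-$ be a flux splitting with $(f^+)'(u)\ge0$ and $(f^-)'(u)\le0$ (for instance one obtained via a Lax--Friedrichs decomposition), let $\alpha\ge\max_u|f'(u)|$, and assume $\nu:=\alpha\,\Delta t/\Delta x\le1$. Let the integer states $q_i^n\in\mathbb Z$ evolve by $$q_i^{n+1}=q_i^n-\bigl(\phi^+(q_i^n)+\phi^-(q_{i+1}^n)-\phi^+(q_{i-1}^n)-\phi^-(q_i^n)\bigr),\qquad \phi^\pm(q)=\mathrm{round}\!\left(f^\pm(\delta q)\frac{\Delta t}{\Delta x}\delta^{-1}\right),$$ and let $u_i^n=\delta q_i^n$ be the reconstruction. Then as $\delta\to0$ with $\delta/\Delta x\to0$, the reconstructed update is consistent with the scalar conservation law $\partial_tu+\partial_xf(u)=0$. More precisely, the update-level residual $$u_i^{n+1}-u_i^n+\frac{\Delta t}{\Delta x}\bigl(\mathcal F(u_i^n,u_{i+1}^n)-\mathcal F(u_{i-1}^n,u_i^n)\bigr)$$ is $\mathcal O(\delta)$, while after division by $\Delta t$ the corresponding operator-level residual $$\frac{u_i^{n+1}-u_i^n}{\Delta t}+\frac{\mathcal F(u_i^n,u_{i+1}^n)-\mathcal F(u_{i-1}^n,u_i^n)}{\Delta x}$$ is $\mathcal O(\delta/\Delta x)$ under fixed CFL scaling (that is, with $\nu$ held fixed).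
   Context: Uniform one-dimensional grid with cell width $\Delta x$, time step $\Delta t$, quantisation resolution $\delta>0$; $f$ is a differentiable flux function. $\mathrm{round}:\mathbb R\to\mathbb Z$ is rounding to the nearest integer. $\mathcal F(u_L,u_R):=f^+(u_L)+f^-(u_R)$ is the classical split numerical flux, which satisfies $\mathcal F(u,u)=f(u)$. "Consistent with the conservation law" means that the residual of the reconstructed update relative to the classical split finite-volume operator $-\frac{\mathcal F(u_i,u_{i+1})-\mathcal F(u_{i-1},u_i)}{\Delta x}$ tends to zero in the stated limit. *)

theory Defs
  imports "HOL-Analysis.Analysis" "HOL-Library.Landau_Symbols"
begin

definition flux_splitting :: "(real \<Rightarrow> real) \<Rightarrow> (real \<Rightarrow> real) \<Rightarrow> (real \<Rightarrow> real) \<Rightarrow> bool" where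
  "flux_splitting f fp fm \<longleftrightarrow>
     (\<forall>u. f u = fp u + fm u) \<and>
     (\<forall>u. fp differentiable (at u) \<and> deriv fp u \<ge> 0) \<and>
     (\<forall>u. fm differentiable (at u) \<and> deriv fm u \<le> 0)"

definition split_flux :: "(real \<Rightarrow> real) \<Rightarrow> (real \<Rightarrow> real) \<Rightarrow> real \<Rightarrow> real \<Rightarrow> real" where
  "split_flux fp fm uL uR = fp uL + fm uR"

text \<open>Discretisation parameters together with the integer states; \<open>state r n i\<close> is the state
  of cell \<open>i\<close> of the two-sided infinite grid at time level \<open>n\<close>.\<close>

record run =
  resolution :: real
  cell_width :: real
  time_step :: real
  state :: "nat \<Rightarrow> int \<Rightarrow> int"

text \<open>The library function \<open>round\<close> resolves ties upwards.\<close>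

definition quantised_flux :: "(real \<Rightarrow> real) \<Rightarrow> run \<Rightarrow> int \<Rightarrow> int" where
  "quantised_flux g r k =
     round (g (resolution r * of_int k) * (time_step r / cell_width r) * inverse (resolution r))"

definition quantised_scheme :: "(real \<Rightarrow> real) \<Rightarrow> (real \<Rightarrow> real) \<Rightarrow> run \<Rightarrow> bool" where
  "quantised_scheme fp fm r \<longleftrightarrow>
     resolution r > 0 \<and> cell_width r > 0 \<and> time_step r > 0 \<and>
     (\<forall>n i. state r (Suc n) i = state r n i
        - (quantised_flux fp r (state r n i) + quantised_flux fm r (state r n (i + 1))
           - quantised_flux fp r (state r n (i - 1)) - quantised_flux fm r (state r n i)))"

definition cfl :: "real \<Rightarrow> run \<Rightarrow> real" where
  "cfl \<alpha> r = \<alpha> * time_step r / cell_width r"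

definition reconstruction :: "run \<Rightarrow> nat \<Rightarrow> int \<Rightarrow> real" where
  "reconstruction r n i = resolution r * of_int (state r n i)"

definition flux_difference :: "(real \<Rightarrow> real) \<Rightarrow> (real \<Rightarrow> real) \<Rightarrow> run \<Rightarrow> nat \<Rightarrow> int \<Rightarrow> real" where
  "flux_difference fp fm r n i =
     split_flux fp fm (reconstruction r n i) (reconstruction r n (i + 1))
     - split_flux fp fm (reconstruction r n (i - 1)) (reconstruction r n i)"

definition update_residual :: "(real \<Rightarrow> real) \<Rightarrow> (real \<Rightarrow> real) \<Rightarrow> run \<Rightarrow> nat \<Rightarrow> int \<Rightarrow> real" where
  "update_residual fp fm r n i =
     reconstruction r (Suc n) i - reconstruction r n i
     + time_step r / cell_width r * flux_difference fp fm r n i"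

definition operator_residual :: "(real \<Rightarrow> real) \<Rightarrow> (real \<Rightarrow> real) \<Rightarrow> run \<Rightarrow> nat \<Rightarrow> int \<Rightarrow> real" where
  "operator_residual fp fm r n i =
     (reconstruction r (Suc n) i - reconstruction r n i) / time_step r
     + flux_difference fp fm r n i / cell_width r"

text \<open>The limit in which the resolution and its ratio to the cell width both tend to zero, along
  runs of the scheme satisfying the side condition \<open>P\<close>. Since the filter lives on triples of a
  run, a time level and a cell, and does not restrict the latter two, asymptotic statements
  along it are uniform in the states, in \<open>n\<close> and in \<open>i\<close>.\<close>

definition refinement ::
  "(real \<Rightarrow> real) \<Rightarrow> (real \<Rightarrow> real) \<Rightarrow> (run \<Rightarrow> bool) \<Rightarrow> (run \<times> nat \<times> int) filter" where
  "refinement fp fm P =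
     inf (principal {(r, n, i). quantised_scheme fp fm r \<and> P r})
       (inf (filtercomap (\<lambda>(r, n, i). resolution r) (nhds 0))
            (filtercomap (\<lambda>(r, n, i). resolution r / cell_width r) (nhds 0)))"

end

theory Submission
  imports Defs
begin

text \<open>The exact split update is what the scheme would perform without rounding. The update of a
  cell contains four rounded fluxes, each off by at most 1/2 in units of the resolution, so the
  update residual is at most twice the resolution. Under fixed CFL number \<open>\<nu>\<close> the time step is
  \<open>\<nu> / \<alpha>\<close> times the cell width, which turns this into the operator-level bound.\<close>

text \<open>Multiplying by \<open>resolution r\<close> undoes the
  \<open>inverse (resolution r)\<close> inside \<open>round\<close>, leaving the resolution times
  the rounding error of one real number.\<close>

lemma quantised_flux_error:
  assumes "resolution r > 0"
  shows "\<bar>resolution r * of_int (quantised_flux g r k)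
           - time_step r / cell_width r * g (resolution r * of_int k)\<bar> \<le> resolution r / 2"
proof -
  define x where
    "x = g (resolution r * of_int k) * (time_step r / cell_width r) * inverse (resolution r)"
  have "resolution r * of_int (quantised_flux g r k)
          - time_step r / cell_width r * g (resolution r * of_int k)
        = resolution r * (of_int (round x) - x)"
    using assms by (simp add: quantised_flux_def x_def field_simps)
  then show ?thesis
    using mult_left_mono[OF of_int_round_abs_le[of x], of "resolution r"] assms
    by (simp add: abs_mult)
qed

lemma update_residual_le:
  assumes "quantised_scheme fp fm r"
  shows "\<bar>update_residual fp fm r n i\<bar> \<le> 2 * resolution r"
proof -
  have pos: "resolution r > 0"
    using assms by (simp add: quantised_scheme_def)
  define err where "err g k = resolution r * of_int (quantised_flux g r k)
    - time_step r / cell_width r * g (resolution r * of_int k)" for g k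
  have step: "state r (Suc n) i = state r n i
        - (quantised_flux fp r (state r n i) + quantised_flux fm r (state r n (i + 1))
           - quantised_flux fp r (state r n (i - 1)) - quantised_flux fm r (state r n i))"
    using assms by (simp add: quantised_scheme_def)
  \<comment> \<open>The old state cancels, and each exact flux in the residual pairs off with its
    rounded counterpart. The triangle inequality on four errors of half a resolution each then gives
    the constant 2.\<close>
  have "update_residual fp fm r n i =
      err fp (state r n (i - 1)) + err fm (state r n i)
      - err fp (state r n i) - err fm (state r n (i + 1))"
    unfolding update_residual_def reconstruction_def flux_difference_def split_flux_def err_def step
    by (simp add: algebra_simps)
  moreover have "\<bar>err g k\<bar> \<le> resolution r / 2" for g k
    unfolding err_def by (rule quantised_flux_error[OF pos])
  note this[of fp "state r n (i - 1)"] this[of fm "state r n i"]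
    this[of fp "state r n i"] this[of fm "state r n (i + 1)"]
  ultimately show ?thesis
    by linarith
qed

lemma operator_residual_eq:
  assumes "quantised_scheme fp fm r"
  shows "operator_residual fp fm r n i = update_residual fp fm r n i / time_step r"
  using assms
  by (simp add: operator_residual_def update_residual_def quantised_scheme_def add_divide_distrib)

lemma operator_residual_le:
  assumes scheme: "quantised_scheme fp fm r" and cfl: "cfl \<alpha> r = \<nu>" and "0 < \<nu>"
  shows "\<bar>operator_residual fp fm r n i\<bar> \<le> 2 * \<alpha> / \<nu> * (resolution r / cell_width r)"
proof -
  have pos: "cell_width r > 0" "time_step r > 0"
    using scheme by (simp_all add: quantised_scheme_def)
  have "\<bar>operator_residual fp fm r n i\<bar> \<le> 2 * resolution r / time_step r"
    using update_residual_le[OF scheme, of n i] pos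
    by (simp add: operator_residual_eq[OF scheme] divide_right_mono)
  \<comment> \<open>Positivity of \<open>\<nu>\<close> rules out \<open>\<alpha> = 0\<close>, so the
    CFL relation can be solved for the reciprocal time step,
    \<open>\<alpha> / (\<nu> * cell_width r)\<close>.\<close>
  also have "\<dots> = 2 * \<alpha> / \<nu> * (resolution r / cell_width r)"
    using cfl \<open>0 < \<nu>\<close> pos by (auto simp: cfl_def field_simps)
  finally show ?thesis .
qed

text \<open>The scheme and the side condition form the principal part of the filter, so an estimate
  valid for each single run, time level and cell passes to it.\<close>

lemma eventually_refinementI:
  assumes "\<And>r n i. quantised_scheme fp fm r \<Longrightarrow> P r \<Longrightarrow> Q (r, n, i)"
  shows "eventually Q (refinement fp fm P)"
  unfolding refinement_def
  by (rule filter_leD[OF inf_le1]) (use assms in \<open>auto simp: eventually_principal\<close>)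

text \<open>The \<open>filtercomap\<close> of this ratio is one of the filters in the infimum. The
  limit turns the operator-level bound into consistency.\<close>

lemma tendsto_mesh_ratio_refinement:
  "((\<lambda>(r, n, i). resolution r / cell_width r) \<longlongrightarrow> 0) (refinement fp fm P)"
  unfolding refinement_def
  by (rule tendsto_mono[OF _ filterlim_filtercomap]) (simp add: le_infI2)

theorem theorem2p3:
  fixes f fp fm :: "real \<Rightarrow> real" and \<alpha> :: real
  assumes "\<forall>u. f differentiable (at u)"
    and "flux_splitting f fp fm"
    and "\<forall>u. \<bar>deriv f u\<bar> \<le> \<alpha>"
  shows "(\<lambda>(r, n, i). update_residual fp fm r n i)
           \<in> O[refinement fp fm (\<lambda>r. cfl \<alpha> r \<le> 1)](\<lambda>(r, n, i). resolution r)
    \<and> (\<forall>\<nu>. 0 < \<nu> \<and> \<nu> \<le> 1 \<longrightarrow>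
         (\<lambda>(r, n, i). operator_residual fp fm r n i)
           \<in> O[refinement fp fm (\<lambda>r. cfl \<alpha> r = \<nu>)](\<lambda>(r, n, i). resolution r / cell_width r)
       \<and> ((\<lambda>(r, n, i). operator_residual fp fm r n i) \<longlongrightarrow> 0)
           (refinement fp fm (\<lambda>r. cfl \<alpha> r = \<nu>)))"
proof (intro conjI allI impI)
  show "(\<lambda>(r, n, i). update_residual fp fm r n i)
      \<in> O[refinement fp fm (\<lambda>r. cfl \<alpha> r \<le> 1)](\<lambda>(r, n, i). resolution r)"
  proof (rule bigoI[where c = 2], rule eventually_refinementI)
    fix r :: run and n :: nat and i :: int
    assume "quantised_scheme fp fm r"
    then show "norm (case (r, n, i) of (r, n, i) \<Rightarrow> update_residual fp fm r n i)
        \<le> 2 * norm (case (r, n, i) of (r, n, i) \<Rightarrow> resolution r)"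
      using update_residual_le[of fp fm r n i] by (simp add: quantised_scheme_def)
  qed
next
  fix \<nu> :: real
  assume \<nu>: "0 < \<nu> \<and> \<nu> \<le> 1"
  show bigo: "(\<lambda>(r, n, i). operator_residual fp fm r n i)
      \<in> O[refinement fp fm (\<lambda>r. cfl \<alpha> r = \<nu>)](\<lambda>(r, n, i). resolution r / cell_width r)"
  \<comment> \<open>Holding the CFL number at \<open>\<nu>\<close> makes this constant the same
    along the whole filter; with only \<open>cfl \<alpha> r \<le> 1\<close> the time step could be
    arbitrarily small compared with the cell width.\<close>
  proof (rule bigoI[where c = "2 * \<alpha> / \<nu>"], rule eventually_refinementI)
    fix r :: run and n :: nat and i :: int
    assume "quantised_scheme fp fm r" "cfl \<alpha> r = \<nu>"
    then show "norm (case (r, n, i) of (r, n, i) \<Rightarrow> operator_residual fp fm r n i)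
        \<le> 2 * \<alpha> / \<nu> * norm (case (r, n, i) of (r, n, i) \<Rightarrow> resolution r / cell_width r)"
      using operator_residual_le[of fp fm r \<alpha> \<nu> n i] \<nu> by (simp add: quantised_scheme_def)
  qed
  \<comment> \<open>Convergence to 0 is recast as being o(1), so that it composes with
    \<open>bigo\<close>.\<close>
  have "(\<lambda>(r, n, i). resolution r / cell_width r)
      \<in> o[refinement fp fm (\<lambda>r. cfl \<alpha> r = \<nu>)](\<lambda>_. 1)"
    by (rule smalloI_tendsto) (simp_all add: tendsto_mesh_ratio_refinement)
  from smalloD_tendsto[OF landau_o.big_small_trans[OF bigo this]]
  show "((\<lambda>(r, n, i). operator_residual fp fm r n i) \<longlongrightarrow> 0)
      (refinement fp fm (\<lambda>r. cfl \<alpha> r = \<nu>))"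
    by simp
qed

end
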